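(* Let $R$ be a subset of a commutative ring $A$ (with identity), let $\lambda,\lambda',\lambda''\in\{\pm1\}$ and $k,l,m>2$. Let $a=(a_1,\dots,a_k)\in R^k$ be a $\lambda$-quiddity cycle, $b=(b_1,\dots,b_l)\in R^l$ a $\lambda'$-quiddity cycle and $c=(c_1,\dots,c_m)\in R^m$ a $\lambda''$-quiddity cycle. Then: (1) $a\oplus b\sim b\oplus a$. (2) There exist $\tau\in D_l$ and $\sigma\in D_{l+m-2}$ such that $(a\oplus b)\oplus c=a\oplus(b^\tau\oplus c)^\sigma$. (3) Let $\sigma\in D_{l+m-2}$. Then either $a\oplus(b\oplus c)^\sigma\sim(a\oplus c^{\tau_1})^{\tau_2}\oplus b$ for some $\tau_1\in D_m$, $\tau_2\in D_{k+m-2}$, or $a\oplus(b\oplus c)^\sigma\sim(a\oplus b^{\tau_1})^{\tau_2}\oplus c$ for some $\tau_1\in D_l$, $\tau_2\in D_{k+l-2}$. (4) If $k=l$, $\lambda=\lambda'$ and $a\oplus b=b\oplus a$, then $a=b$.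
   Context: For $\mu\in\{\pm1\}$, a $\mu$-quiddity cycle is a finite sequence $c=(c_1,\dots,c_n)$ of ring elements such that $\prod_{t=1}^{n}\begin{pmatrix} c_t & -1\\ 1 & 0\end{pmatrix}=\mu\,\mathrm{id}$ (product in the order $t=1,\dots,n$). For sequences $a=(a_1,\dots,a_k)$, $b=(b_1,\dots,b_l)$ one defines $a\oplus b=(a_1+b_l,a_2,\dots,a_{k-1},a_k+b_1,b_2,\dots,b_{l-1})$ (sums in $A$), a sequence of length $k+l-2$. Let $D_n$ be the dihedral group acting on the positions $\{1,\dots,n\}$ (generated by the rotation $i\mapsto i+1 \bmod n$ and the reflection $i\mapsto n+1-i$); for a sequence $x=(x_1,\dots,x_n)$ and $\sigma\in D_n$ put $x^\sigma=(x_{\sigma(1)},\dots,x_{\sigma(n)})$, i.e. a cyclic rotation of $x$ or of its reversal. For tuples $x,y$ of the same length $n$, $x\sim y$ means there is $\sigma\in D_n$ with $x=y^\sigma$. *)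

theory Defs
  imports "Jordan_Normal_Form.Matrix" "HOL-Algebra.Sym_Groups"
begin

(* The ring sort {comm_ring, comm_monoid_mult} consists of all commutative rings with identity,
   including the trivial ring, which comm_ring_1 would exclude. *)

definition quiddity_mat :: "'a \<Rightarrow> 'a::{comm_ring, comm_monoid_mult} mat" where
  "quiddity_mat t = mat_of_rows_list 2 [[t, - 1], [1, 0]]"

(* The product is taken in the order of the list: M(c_1) * (M(c_2) * ... ).
   Intended for mu = 1 or mu = -1. *)
definition quiddity_cycle :: "'a \<Rightarrow> 'a::{comm_ring, comm_monoid_mult} list \<Rightarrow> bool" where
  "quiddity_cycle \<mu> c \<longleftrightarrow> foldr (*) (map quiddity_mat c) (1\<^sub>m 2) = \<mu> \<cdot>\<^sub>m 1\<^sub>m 2"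

(* (a_1 + b_l, a_2, ..., a_{k-1}, a_k + b_1, b_2, ..., b_{l-1}); meaningful for k, l >= 2. *)
definition qsum :: "'a::plus list \<Rightarrow> 'a list \<Rightarrow> 'a list" (infixl \<open>\<oplus>\<^sub>q\<close> 65) where
  "a \<oplus>\<^sub>q b =
     [hd a + last b] @ butlast (tl a) @ [last a + hd b] @ butlast (tl b)"

lemma length_qsum: "2 \<le> length a \<Longrightarrow> 2 \<le> length b \<Longrightarrow> length (a \<oplus>\<^sub>q b) = length a + length b - 2"
  by (simp add: qsum_def)

(* Positions are 1, ..., n; both generators fix every number outside {1..n}. *)
definition rotation :: "nat \<Rightarrow> nat \<Rightarrow> nat" where
  "rotation n i = (if i \<in> {1..n} then i mod n + 1 else i)"

definition reflection :: "nat \<Rightarrow> nat \<Rightarrow> nat" where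
  "reflection n i = (if i \<in> {1..n} then n + 1 - i else i)"

definition dihedral :: "nat \<Rightarrow> (nat \<Rightarrow> nat) set" where
  "dihedral n = generate (sym_group n) {rotation n, reflection n}"

lemma rotation_in_sym_group: "rotation n \<in> carrier (sym_group n)"
proof -
  have "inj_on (rotation n) {1..n}"
  proof (rule inj_onI)
    fix i j assume "i \<in> {1..n}" "j \<in> {1..n}" "rotation n i = rotation n j"
    then show "i = j"
      by (cases "i = n"; cases "j = n") (auto simp: rotation_def)
  qed
  moreover have "rotation n ` {1..n} \<subseteq> {1..n}"
    by (auto simp: rotation_def Suc_le_eq)
  ultimately have "bij_betw (rotation n) {1..n} {1..n}"
    by (simp add: bij_betw_def endo_inj_surj)
  then show ?thesis
    unfolding sym_group_carrier by (rule bij_imp_permutes) (auto simp: rotation_def)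
qed

lemma reflection_in_sym_group: "reflection n \<in> carrier (sym_group n)"
proof -
  have "bij_betw (reflection n) {1..n} {1..n}"
    by (rule bij_betw_byWitness[where f' = "reflection n"]) (auto simp: reflection_def)
  then show ?thesis
    unfolding sym_group_carrier by (rule bij_imp_permutes) (auto simp: reflection_def)
qed

lemma dihedral_subgroup: "subgroup (dihedral n) (sym_group n)"
  unfolding dihedral_def
  by (rule group.generate_is_subgroup[OF sym_group_is_group])
     (simp add: rotation_in_sym_group reflection_in_sym_group)

(* x^sigma = (x_{sigma(1)}, ..., x_{sigma(n)}); list indices start at 0, positions at 1. *)
definition act :: "'a list \<Rightarrow> (nat \<Rightarrow> nat) \<Rightarrow> 'a list" where
  "act x \<sigma> = map (\<lambda>i. x ! (\<sigma> i - 1)) [1..<length x + 1]"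

definition dihedral_equiv :: "'a list \<Rightarrow> 'a list \<Rightarrow> bool" (infix \<open>\<sim>\<^sub>D\<close> 50) where
  "x \<sim>\<^sub>D y \<longleftrightarrow> length x = length y \<and> (\<exists>\<sigma>\<in>dihedral (length y). x = act y \<sigma>)"

end

theory Submission
  imports Defs
begin

text \<open>Think of a cycle as a polygon with entries at its vertices; then \<open>a \<oplus>\<^sub>q b\<close> glues \<open>a\<close> to \<open>b\<close>
  along the edge joining the last to the first vertex of each, and the dihedral action moves
  that edge and the orientation. Every edge of \<open>b \<oplus>\<^sub>q c\<close> comes either from \<open>b\<close> or from \<open>c\<close>, so a
  polygon glued to \<open>b \<oplus>\<^sub>q c\<close> is glued to \<open>b\<close> or to \<open>c\<close>, and the two gluings can be performed in
  either order. The first three claims hold for arbitrary lists. Only the last claim uses the matrix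
  equation: \<open>a \<oplus>\<^sub>q b = b \<oplus>\<^sub>q a\<close> forces the inner entries of \<open>a\<close> and \<open>b\<close> to agree, and the
  product of the inner matrices determines the first and the last entry of the cycle.\<close>

section \<open>The dihedral action on lists\<close>

lemma length_act [simp]: "length (act x \<sigma>) = length x"
  by (simp add: act_def del: upt_Suc)

lemma nth_act: "i < length x \<Longrightarrow> act x \<sigma> ! i = x ! (\<sigma> (Suc i) - 1)"
  by (simp add: act_def del: upt_Suc)

lemma act_id: "act x id = x"
  by (rule nth_equalityI) (simp_all add: nth_act)

text \<open>This is a right action. Since \<open>\<tau>\<close> preserves
  \<open>{1..length x}\<close>, its values are never 0, so the shift between positions and indices
  is undone exactly.\<close>

lemma act_comp:
  assumes "\<tau> permutes {1..length x}"
  shows "act x (\<sigma> \<circ> \<tau>) = act (act x \<sigma>) \<tau>"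
proof (rule nth_equalityI)
  fix i assume "i < length (act x (\<sigma> \<circ> \<tau>))"
  then have i: "i < length x" by simp
  then have "\<tau> (Suc i) \<in> {1..length x}"
    by (subst permutes_in_image[OF assms]) simp
  then obtain j where "\<tau> (Suc i) = Suc j" and "j < length x"
    by (cases "\<tau> (Suc i)") auto
  then show "act x (\<sigma> \<circ> \<tau>) ! i = act (act x \<sigma>) \<tau> ! i"
    using i by (simp add: nth_act)
qed simp

lemma act_rotation: "act x (rotation (length x)) = rotate1 x"
  by (rule nth_equalityI) (auto simp: nth_act rotation_def nth_rotate1)

lemma act_reflection: "act x (reflection (length x)) = rev x"
  by (rule nth_equalityI) (auto simp: nth_act reflection_def rev_nth)

lemma dihedral_permutes: "\<sigma> \<in> dihedral n \<Longrightarrow> \<sigma> permutes {1..n}"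
  using subgroup.mem_carrier[OF dihedral_subgroup] by (simp add: sym_group_carrier)

lemma dihedral_comp: "\<sigma> \<in> dihedral n \<Longrightarrow> \<tau> \<in> dihedral n \<Longrightarrow> \<sigma> \<circ> \<tau> \<in> dihedral n"
  using subgroup.m_closed[OF dihedral_subgroup] by (simp add: sym_group_mult)

lemma rotation_in_dihedral: "rotation n \<in> dihedral n"
  unfolding dihedral_def by (rule generate.incl) simp

lemma reflection_in_dihedral: "reflection n \<in> dihedral n"
  unfolding dihedral_def by (rule generate.incl) simp

lemma id_in_dihedral: "id \<in> dihedral n"
  using subgroup.one_closed[OF dihedral_subgroup] by (simp add: sym_group_one)

text \<open>Serves to return from equivalence to a group element when the degree is given as a
  number such as \<open>l + m - 2\<close>.\<close>

lemma dihedral_equiv_iff_act: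
  "length y = n \<Longrightarrow> x \<sim>\<^sub>D y \<longleftrightarrow> (\<exists>\<sigma>\<in>dihedral n. x = act y \<sigma>)"
  by (auto simp: dihedral_equiv_def)

lemma dihedral_equiv_refl: "x \<sim>\<^sub>D x"
  unfolding dihedral_equiv_def using id_in_dihedral act_id by metis

lemma dihedral_equiv_trans [trans]:
  assumes "x \<sim>\<^sub>D y" and "y \<sim>\<^sub>D z"
  shows "x \<sim>\<^sub>D z"
  using assms unfolding dihedral_equiv_def
  by (metis act_comp dihedral_comp dihedral_permutes)

lemma rev_dihedral_equiv: "rev x \<sim>\<^sub>D x"
  unfolding dihedral_equiv_def using reflection_in_dihedral act_reflection by (metis length_rev)

lemma rotate_dihedral_equiv: "rotate n x \<sim>\<^sub>D x"
proof (induction n)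
  case 0
  show ?case by (simp add: dihedral_equiv_refl)
next
  case (Suc n)
  have "rotate1 y \<sim>\<^sub>D y" for y :: "'a list"
    unfolding dihedral_equiv_def using rotation_in_dihedral act_rotation by (metis length_rotate1)
  from this[of "rotate n x"] Suc.IH have "rotate1 (rotate n x) \<sim>\<^sub>D x"
    by (rule dihedral_equiv_trans)
  then show ?case by simp
qed

lemma append_swap_dihedral_equiv: "u @ v \<sim>\<^sub>D v @ u"
  using rotate_dihedral_equiv[of "length v" "v @ u"] by (simp add: rotate_append)

text \<open>Rotations and reversed rotations include both generators and are closed under inverses
  and composition. The list stays arbitrary in the induction because the second factor of a product
  acts on \<open>act x h1\<close>.\<close>

lemma act_dihedral_cases:
  assumes "\<sigma> \<in> dihedral n" and "length x = n"
  shows "\<exists>i. act x \<sigma> = rotate i x \<or> act x \<sigma> = rev (rotate i x)"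
  using assms unfolding dihedral_def
proof (induction arbitrary: x rule: generate.induct)
  case one
  have "act x \<one>\<^bsub>sym_group n\<^esub> = rotate 0 x"
    unfolding sym_group_one act_id by (simp only: rotate0 id_apply)
  then show ?case by blast
next
  case (incl h)
  then consider "h = rotation n" | "h = reflection n" by blast
  then show ?case
  proof cases
    case 1
    then have "act x h = rotate 1 x" using act_rotation[of x] incl.prems by simp
    then show ?thesis by blast
  next
    case 2
    then have "act x h = rev (rotate 0 x)" using act_reflection[of x] incl.prems by simp
    then show ?thesis by blast
  qed
next
  case (inv h)
  define z where "z = act x (inv\<^bsub>sym_group n\<^esub> h)"
  have h: "h \<in> carrier (sym_group n)"
    using inv.hyps rotation_in_sym_group reflection_in_sym_group by blast
  then have perm: "h permutes {1..n}" by (simp add: sym_group_carrier)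
  \<comment> \<open>The inverse is never computed: \<open>z\<close> is recovered from the fact that
    the generator \<open>h\<close> takes it back to \<open>x\<close>.\<close>
  have "act z h = act x (inv\<^bsub>sym_group n\<^esub> h \<circ> h)"
    unfolding z_def using perm inv.prems by (simp add: act_comp)
  also have "inv\<^bsub>sym_group n\<^esub> h \<circ> h = id"
    using group.l_inv[OF sym_group_is_group h] by (simp add: sym_group_mult sym_group_one)
  finally have zh: "act z h = x" unfolding act_id .
  have len: "length z = n" by (simp add: z_def inv.prems)
  from inv.hyps consider "h = rotation n" | "h = reflection n" by blast
  then have "z = rotate (n - 1) x \<or> z = rev (rotate 0 x)"
  proof cases
    case 1
    then have "rotate1 z = x" using zh len act_rotation by metis
    \<comment> \<open>A rotation is undone by \<open>n - 1\<close> further ones. For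
      \<open>n = 0\<close> the truncated sum \<open>n - 1 + 1\<close> is 1, which is harmless on the
      empty list.\<close>
    then have "rotate (n - 1) x = rotate (n - 1 + 1) z"
      using rotate_rotate[of "n - 1" 1 z] by simp
    also have "\<dots> = z"
    proof (cases n)
      case 0
      then show ?thesis using len by simp
    next
      case (Suc n')
      then show ?thesis using len by (intro rotate_id) simp
    qed
    finally show ?thesis by simp
  next
    case 2
    then have "rev z = x" using zh len act_reflection by metis
    then show ?thesis by auto
  qed
  then show ?case unfolding z_def by blast
next
  case (eng h1 h2)
  have "h2 permutes {1..n}"
    using dihedral_permutes eng.hyps(2) unfolding dihedral_def by blast
  then have "act x (h1 \<otimes>\<^bsub>sym_group n\<^esub> h2) = act (act x h1) h2"
    using eng.prems by (simp add: sym_group_mult act_comp)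
  moreover obtain i where "act x h1 = rotate i x \<or> act x h1 = rev (rotate i x)"
    using eng.IH(1) eng.prems by blast
  moreover obtain j where "act (act x h1) h2 = rotate j (act x h1) \<or>
      act (act x h1) h2 = rev (rotate j (act x h1))"
    using eng.IH(2)[of "act x h1"] eng.prems by auto
  \<comment> \<open>Reversal turns a rotation into one in the other direction, so it can be moved
    outermost, where two reversals cancel.\<close>
  moreover have "\<exists>j'. rotate j (rev (rotate i x)) = rev (rotate j' x)"
    unfolding rotate_rev rotate_rotate by blast
  ultimately show ?case
    using rotate_rotate[of j i x] rev_rev_ident by metis
qed

text \<open>Replaces the group element by a cut of the list into two blocks, so that list equations
  can locate the cut.\<close>

lemma dihedral_equivE:
  assumes "x \<sim>\<^sub>D y"
  obtains u v where "y = u @ v" and "x = v @ u \<or> x = rev (v @ u)"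
proof -
  obtain i where i: "x = rotate i y \<or> x = rev (rotate i y)"
    using assms act_dihedral_cases unfolding dihedral_equiv_def by metis
  then show thesis
    using that[of "take (i mod length y) y" "drop (i mod length y) y"]
    by (simp add: rotate_drop_take)
qed

lemma dihedral_equiv_sym:
  assumes "x \<sim>\<^sub>D y"
  shows "y \<sim>\<^sub>D x"
proof -
  obtain u v where uv: "y = u @ v" "x = v @ u \<or> x = rev (v @ u)"
    using assms by (rule dihedral_equivE)
  have "u @ v \<sim>\<^sub>D rev (rev (v @ u))"
    by (simp add: append_swap_dihedral_equiv)
  also have "rev (rev (v @ u)) \<sim>\<^sub>D rev (v @ u)"
    by (rule rev_dihedral_equiv)
  finally show ?thesis
    using uv append_swap_dihedral_equiv by auto
qed

section \<open>Gluing cycles\<close>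

lemma list_ends:
  assumes "2 \<le> length xs"
  obtains x ys y where "xs = x # ys @ [y]"
proof (cases xs)
  case (Cons x zs)
  with assms have "zs \<noteq> []" by auto
  then show thesis using that Cons by (metis append_butlast_last_id)
qed (use assms in simp)

lemma qsum_Cons_snoc: "(x # p @ [y]) \<oplus>\<^sub>q (u # q @ [v]) = (x + v) # p @ (y + u) # q"
  by (simp add: qsum_def)

text \<open>Both sums consist of the same two blocks, one from each summand, in opposite
  order.\<close>

lemma qsum_commute:
  fixes a b :: "'a::ab_semigroup_add list"
  assumes "2 \<le> length a" and "2 \<le> length b"
  shows "a \<oplus>\<^sub>q b \<sim>\<^sub>D b \<oplus>\<^sub>q a"
proof -
  obtain x p y where a: "a = x # p @ [y]" using assms(1) by (rule list_ends)
  obtain u q v where b: "b = u # q @ [v]" using assms(2) by (rule list_ends)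
  show ?thesis
    using append_swap_dihedral_equiv[of "(x + v) # p" "(y + u) # q"]
    by (simp add: a b qsum_Cons_snoc add.commute)
qed

text \<open>Turning over the whole glued polygon reverses both pieces at once, so a reflection of
  \<open>w\<close> can be traded for one of \<open>a\<close>.\<close>

lemma qsum_rev_right:
  assumes "2 \<le> length a" and "2 \<le> length w"
  shows "a \<oplus>\<^sub>q rev w \<sim>\<^sub>D rev a \<oplus>\<^sub>q w"
proof -
  obtain x p y where a: "a = x # p @ [y]" using assms(1) by (rule list_ends)
  obtain u q v where w: "w = u # q @ [v]" using assms(2) by (rule list_ends)
  have "rev a \<oplus>\<^sub>q w = [y + v] @ (rev p @ [x + u] @ q)"
    using qsum_Cons_snoc[of y "rev p" x u q v] by (simp add: a w)
  moreover have "a \<oplus>\<^sub>q rev w = (x + u) # p @ (y + v) # rev q"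
    using qsum_Cons_snoc[of x p y v "rev q" u] by (simp add: a w)
  then have "rev (a \<oplus>\<^sub>q rev w) = (q @ [y + v]) @ (rev p @ [x + u])" by simp
  moreover have "(q @ [y + v]) @ (rev p @ [x + u]) \<sim>\<^sub>D (rev p @ [x + u]) @ (q @ [y + v])"
    by (rule append_swap_dihedral_equiv)
  moreover have "(rev p @ [x + u] @ q) @ [y + v] \<sim>\<^sub>D [y + v] @ (rev p @ [x + u] @ q)"
    by (rule append_swap_dihedral_equiv)
  ultimately have "rev (a \<oplus>\<^sub>q rev w) \<sim>\<^sub>D rev a \<oplus>\<^sub>q w"
    using dihedral_equiv_trans by simp
  then show ?thesis
    using dihedral_equiv_trans[OF dihedral_equiv_sym[OF rev_dihedral_equiv]] by blast
qed

lemma qsum_assoc_rotated: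
  fixes a b c :: "'a::ab_semigroup_add list"
  assumes "2 \<le> length a" and "2 < length b" and "2 \<le> length c"
  shows "\<exists>b' w. b' \<sim>\<^sub>D b \<and> w \<sim>\<^sub>D b' \<oplus>\<^sub>q c \<and> (a \<oplus>\<^sub>q b) \<oplus>\<^sub>q c = a \<oplus>\<^sub>q w"
proof -
  obtain x p y where a: "a = x # p @ [y]" using assms(1) by (rule list_ends)
  obtain u q v where b: "b = u # q @ [v]" using assms(2) by (elim list_ends[OF less_imp_le])
  obtain s r t where c: "c = s # r @ [t]" using assms(3) by (rule list_ends)
  \<comment> \<open>The closing edge of \<open>a \<oplus>\<^sub>q b\<close>, to which
    \<open>c\<close> is glued, joins the inner vertex \<open>z\<close> of \<open>b\<close> to the
    merged vertex \<open>x + v\<close>.\<close>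
  from assms(2) b obtain q' z where q: "q = q' @ [z]" by (cases q rule: rev_cases) auto
  \<comment> \<open>\<open>?b'\<close> makes the edge from \<open>z\<close> to \<open>v\<close> the
    closing edge, ready for \<open>c\<close>; \<open>?w\<close> then rotates until the edge from
    \<open>v + t\<close> to \<open>u\<close> closes the polygon, ready for \<open>a\<close>.\<close>
  let ?b' = "[v] @ u # q" and ?w = "(u # q' @ (z + s) # r) @ [v + t]"
  have "?b' \<sim>\<^sub>D b"
    using append_swap_dihedral_equiv[of "[v]" "u # q"] by (simp add: b)
  moreover have "?b' \<oplus>\<^sub>q c = [v + t] @ (u # q' @ (z + s) # r)"
    using qsum_Cons_snoc[of v "u # q'" z s r t] by (simp add: q c)
  then have "?w \<sim>\<^sub>D ?b' \<oplus>\<^sub>q c"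
    using append_swap_dihedral_equiv[of "u # q' @ (z + s) # r" "[v + t]"] by simp
  moreover have "(a \<oplus>\<^sub>q b) \<oplus>\<^sub>q c = (x + v + t) # (p @ (y + u) # q') @ (z + s) # r"
    using qsum_Cons_snoc[of x p y u q v] qsum_Cons_snoc[of "x + v" "p @ (y + u) # q'" z s r t]
    by (simp add: a b q c)
  moreover have "a \<oplus>\<^sub>q ?w = (x + (v + t)) # p @ (y + u) # q' @ (z + s) # r"
    using qsum_Cons_snoc[of x p y u "q' @ (z + s) # r" "v + t"] by (simp add: a)
  ultimately show ?thesis by (metis (no_types, lifting) add.assoc append.assoc append_Cons)
qed

text \<open>For \<open>b = u # q1 @ q2 @ [v]\<close>, the list \<open>w\<close> is \<open>b \<oplus>\<^sub>q c\<close> cut open at an edge of \<open>b\<close>;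
  thus \<open>a\<close> can be glued to \<open>b\<close> first.\<close>

lemma qsum_glue_rotated:
  fixes a c :: "'a::ab_semigroup_add list"
  assumes "2 \<le> length a" and "q1 @ q2 \<noteq> []"
    and c: "c = s # r @ [t]" and w: "w = q2 @ (v + s) # r @ (u + t) # q1"
  shows "\<exists>y. y \<sim>\<^sub>D a \<oplus>\<^sub>q (q2 @ [v] @ [u] @ q1) \<and> a \<oplus>\<^sub>q w \<sim>\<^sub>D y \<oplus>\<^sub>q c"
proof -
  obtain x p y where a: "a = x # p @ [y]" using assms(1) by (rule list_ends)
  \<comment> \<open>The emptiness of \<open>q1\<close> and \<open>q2\<close> decides whether the
    closing edge of \<open>w\<close> ends at inner vertices of \<open>b\<close> or at the vertices
    already merged with \<open>c\<close>.\<close>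
  consider
    (none) "q1 = []" "q2 = []"
    | (left) d q2' where "q1 = []" "q2 = d # q2'"
    | (right) e q1' where "q1 = q1' @ [e]" "q2 = []"
    | (both) d q2' e q1' where "q1 = q1' @ [e]" "q2 = d # q2'"
    by (metis neq_Nil_conv rev_exhaust)
  then show ?thesis
  proof cases
    case none
    with assms(2) show ?thesis by simp
  next
    case left
    \<comment> \<open>In every case \<open>?Y\<close> is \<open>a\<close> glued to \<open>b\<close>,
      rotated so that the vertex of \<open>u\<close> comes first and that of \<open>v\<close> last,
      which is where \<open>c\<close> attaches.\<close>
    let ?Y = "[x + u] @ (p @ (y + d) # q2' @ [v])"
    have "a \<oplus>\<^sub>q (q2 @ [v] @ [u] @ q1) = ?Y"
      using qsum_Cons_snoc[of x p y d "q2' @ [v]" u] by (simp add: a left)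
    moreover have "a \<oplus>\<^sub>q w = ?Y \<oplus>\<^sub>q c"
      using qsum_Cons_snoc[of x p y d "q2' @ (v + s) # r" "u + t"]
        qsum_Cons_snoc[of "x + u" "p @ (y + d) # q2'" v s r t]
      by (simp add: a w c left add.assoc)
    ultimately show ?thesis using dihedral_equiv_refl by metis
  next
    case right
    let ?Y = "(u # q1' @ (x + e) # p) @ [y + v]"
    have "a \<oplus>\<^sub>q (q2 @ [v] @ [u] @ q1) = (x + e) # p @ (y + v) # u # q1'"
      using qsum_Cons_snoc[of x p y v "u # q1'" e] by (simp add: a right)
    moreover have "?Y \<sim>\<^sub>D (x + e) # p @ (y + v) # u # q1'"
      using append_swap_dihedral_equiv[of "u # q1'" "(x + e) # p @ [y + v]"] by simp
    moreover have "a \<oplus>\<^sub>q w = ((x + e) # p @ (y + (v + s)) # r) @ ((u + t) # q1')"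
      using qsum_Cons_snoc[of x p y "v + s" "r @ (u + t) # q1'" e] by (simp add: a w right)
    moreover have "?Y \<oplus>\<^sub>q c = ((u + t) # q1') @ ((x + e) # p @ (y + (v + s)) # r)"
      using qsum_Cons_snoc[of u "q1' @ (x + e) # p" "y + v" s r t] by (simp add: c add.assoc)
    ultimately show ?thesis using append_swap_dihedral_equiv by metis
  next
    case both
    let ?Y = "(u # q1' @ (x + e) # p @ (y + d) # q2') @ [v]"
    have "a \<oplus>\<^sub>q (q2 @ [v] @ [u] @ q1) = (x + e) # p @ (y + d) # q2' @ v # u # q1'"
      using qsum_Cons_snoc[of x p y d "q2' @ v # u # q1'" e] by (simp add: a both)
    moreover have "?Y \<sim>\<^sub>D (x + e) # p @ (y + d) # q2' @ v # u # q1'"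
      using append_swap_dihedral_equiv[of "u # q1'" "(x + e) # p @ (y + d) # q2' @ [v]"] by simp
    moreover have "a \<oplus>\<^sub>q w = ((x + e) # p @ (y + d) # q2' @ (v + s) # r) @ ((u + t) # q1')"
      using qsum_Cons_snoc[of x p y d "q2' @ (v + s) # r @ (u + t) # q1'" e]
      by (simp add: a w both)
    moreover have "?Y \<oplus>\<^sub>q c = ((u + t) # q1') @ ((x + e) # p @ (y + d) # q2' @ (v + s) # r)"
      using qsum_Cons_snoc[of u "q1' @ (x + e) # p @ (y + d) # q2'" v s r t] by (simp add: c)
    ultimately show ?thesis using append_swap_dihedral_equiv by metis
  qed
qed

text \<open>Cutting \<open>b \<oplus>\<^sub>q c\<close> at an edge amounts to cutting it either at an edge of \<open>b\<close> or at one of \<open>c\<close>;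
  the two ways of cutting are exchanged by swapping \<open>b\<close> and \<open>c\<close>.\<close>

lemma qsum_rotate_cases:
  fixes b c :: "'a::ab_semigroup_add list"
  assumes b: "b = u # q @ [v]" and c: "c = s # r @ [t]" and uv: "b \<oplus>\<^sub>q c = g @ h"
  shows "(\<exists>q1 q2. q = q1 @ q2 \<and> h @ g = q2 @ (v + s) # r @ (u + t) # q1) \<or>
    (\<exists>r1 r2. r = r1 @ r2 \<and> h @ g = r2 @ (t + u) # q @ (s + v) # r1)"
proof -
  have gh: "(u + t) # q @ (v + s) # r = g @ h"
    using uv by (simp add: b c qsum_Cons_snoc)
  show ?thesis
  proof (cases g)
    case Nil
    then have "r = r @ []" "h @ g = [] @ (t + u) # q @ (s + v) # r"
      using gh by (simp_all add: add.commute)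
    then show ?thesis by blast
  next
    case (Cons x g')
    then have x: "x = u + t" and "q @ (v + s) # r = g' @ h" using gh by auto
    then consider k where "q = g' @ k" "h = k @ (v + s) # r"
      | k where "g' = q @ k" "(v + s) # r = k @ h"
      by (auto simp: append_eq_append_conv2)
    then show ?thesis
    proof cases
      case 1
      then show ?thesis using x Cons by auto
    next
      case 2
      \<comment> \<open>If \<open>k\<close> is empty, the cut falls just before
        \<open>v + s\<close>, still on an edge of \<open>b\<close>; otherwise it lies beyond that
        vertex, on an edge of \<open>c\<close>.\<close>
      show ?thesis
      proof (cases k)
        case Nil
        with 2 x Cons have "q = q @ []" "h @ g = [] @ (v + s) # r @ (u + t) # q" by auto
        then show ?thesis by blast
      next
        case (Cons z k')
        with 2 have "r = k' @ h" "z = v + s" by auto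
        then show ?thesis using 2 x Cons \<open>g = x # g'\<close> by (auto simp: add.commute)
      qed
    qed
  qed
qed
text \<open>The third claim with equivalences in place of group elements. For a rotated
  \<open>b \<oplus>\<^sub>q c\<close> the position of the cut decides the alternative; a reversed
  one is reduced to this by reflecting \<open>a\<close>.\<close>

lemma qsum_glue_cases:
  fixes a b c w :: "'a::ab_semigroup_add list"
  assumes a: "2 \<le> length a" and b: "2 < length b" and c: "2 < length c"
    and w: "w \<sim>\<^sub>D b \<oplus>\<^sub>q c"
  shows "(\<exists>c' y. c' \<sim>\<^sub>D c \<and> y \<sim>\<^sub>D a \<oplus>\<^sub>q c' \<and> a \<oplus>\<^sub>q w \<sim>\<^sub>D y \<oplus>\<^sub>q b) \<or>
    (\<exists>b' y. b' \<sim>\<^sub>D b \<and> y \<sim>\<^sub>D a \<oplus>\<^sub>q b' \<and> a \<oplus>\<^sub>q w \<sim>\<^sub>D y \<oplus>\<^sub>q c)"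
    (is "?glued a w")
proof -
  obtain g h where gh: "b \<oplus>\<^sub>q c = g @ h" "w = h @ g \<or> w = rev (h @ g)"
    using w by (rule dihedral_equivE)
  \<comment> \<open>Stated for any \<open>a'\<close>, because the reversed case applies it to
    \<open>rev a\<close>.\<close>
  have glued: "?glued a' (h @ g)" if a': "2 \<le> length a'" for a'
  proof -
    obtain u q v where bl: "b = u # q @ [v]" using b by (elim list_ends[OF less_imp_le])
    obtain s r t where cl: "c = s # r @ [t]" using c by (elim list_ends[OF less_imp_le])
    from qsum_rotate_cases[OF bl cl gh(1)] show ?thesis
    proof (elim disjE exE conjE)
      fix q1 q2 assume q: "q = q1 @ q2" and hg: "h @ g = q2 @ (v + s) # r @ (u + t) # q1"
      have "q1 @ q2 \<noteq> []" using b bl q by auto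
      from qsum_glue_rotated[OF a' this cl hg] obtain y
        where y: "y \<sim>\<^sub>D a' \<oplus>\<^sub>q (q2 @ [v] @ [u] @ q1)" "a' \<oplus>\<^sub>q (h @ g) \<sim>\<^sub>D y \<oplus>\<^sub>q c" by blast
      have "q2 @ [v] @ [u] @ q1 \<sim>\<^sub>D b"
        using append_swap_dihedral_equiv[of "q2 @ [v]" "[u] @ q1"] by (simp add: bl q)
      with y show ?thesis by blast
    next
      fix r1 r2 assume r: "r = r1 @ r2" and hg: "h @ g = r2 @ (t + u) # q @ (s + v) # r1"
      have "r1 @ r2 \<noteq> []" using c cl r by auto
      from qsum_glue_rotated[OF a' this bl hg] obtain y
        where y: "y \<sim>\<^sub>D a' \<oplus>\<^sub>q (r2 @ [t] @ [s] @ r1)" "a' \<oplus>\<^sub>q (h @ g) \<sim>\<^sub>D y \<oplus>\<^sub>q b" by blast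
      have "r2 @ [t] @ [s] @ r1 \<sim>\<^sub>D c"
        using append_swap_dihedral_equiv[of "r2 @ [t]" "[s] @ r1"] by (simp add: cl r)
      with y show ?thesis by blast
    qed
  qed
  show ?thesis
  proof (cases "w = h @ g")
    case True
    then show ?thesis using glued[OF a] by simp
  next
    case False
    then have w: "w = rev (h @ g)" using gh(2) by blast
    have "length (h @ g) = length b + length c - 2"
      using length_qsum[of b c] b c gh(1) by simp
    then have aw: "a \<oplus>\<^sub>q w \<sim>\<^sub>D rev a \<oplus>\<^sub>q (h @ g)"
      unfolding w using a b c by (intro qsum_rev_right) linarith+
    \<comment> \<open>Transfers the reflection back from \<open>a\<close> to the copy of
      \<open>b\<close> or \<open>c\<close> glued to it, whose equivalence class is unchanged by
      reversal.\<close>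
    have flip: "rev x \<sim>\<^sub>D z \<and> y \<sim>\<^sub>D a \<oplus>\<^sub>q rev x"
      if "x \<sim>\<^sub>D z" and "y \<sim>\<^sub>D rev a \<oplus>\<^sub>q x" and "2 < length z" for x y z :: "'a list"
    proof -
      have "2 \<le> length x" using that by (simp add: dihedral_equiv_def)
      then have "rev a \<oplus>\<^sub>q x \<sim>\<^sub>D a \<oplus>\<^sub>q rev x"
        using a by (intro dihedral_equiv_sym[OF qsum_rev_right])
      then show ?thesis
        using that rev_dihedral_equiv dihedral_equiv_trans by blast
    qed
    have "2 \<le> length (rev a)" using a by simp
    from glued[OF this] show ?thesis
      using flip b c dihedral_equiv_trans[OF aw] by meson
  qed
qed

section \<open>Recovering the end entries of a quiddity cycle\<close>

lemma index_mult_mat_2: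
  assumes "A \<in> carrier_mat 2 2" and "B \<in> carrier_mat 2 2" and "i < 2" and "j < 2"
  shows "(A * B) $$ (i, j) = A $$ (i, 0) * B $$ (0, j) + A $$ (i, 1) * B $$ (1, j)"
proof -
  have "(A * B) $$ (i, j) = row A i \<bullet> col B j"
    using assms by (intro index_mult_mat(1)) auto
  also have "\<dots> = (\<Sum>k = 0..<2. row A i $ k * col B j $ k)"
    using assms unfolding scalar_prod_def by (metis carrier_matD(1) dim_col)
  also have "\<dots> = row A i $ 0 * col B j $ 0 + row A i $ 1 * col B j $ 1"
    by (simp only: numeral_2_eq_2 sum.atLeast0_lessThan_Suc
        atLeastLessThan_empty order_refl sum.empty add_0 One_nat_def)
  finally show ?thesis
    using assms by (metis carrier_matD index_row(1) index_col pos2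
        one_less_numeral_iff semiring_norm(76))
qed

lemma quiddity_mat_carrier: "quiddity_mat t \<in> carrier_mat 2 2"
  by (rule carrier_matI) (simp_all add: quiddity_mat_def mat_of_rows_list_def)

lemma index_quiddity_mat:
  "quiddity_mat t $$ (0, 0) = t" "quiddity_mat t $$ (0, 1) = - 1"
  "quiddity_mat t $$ (1, 0) = 1" "quiddity_mat t $$ (1, 1) = 0"
  by (simp_all add: quiddity_mat_def mat_of_rows_list_def)

text \<open>The unit laws of the library are stated for \<open>semiring_1\<close>, which excludes \<open>1 = 0\<close>.\<close>

lemma one_mult_mat_2:
  fixes N :: "'a::{comm_ring, comm_monoid_mult} mat"
  assumes "N \<in> carrier_mat 2 2"
  shows "1\<^sub>m 2 * N = N" and "N * 1\<^sub>m 2 = N"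
proof -
  have ij: "i = 0 \<or> i = 1" if "i < 2" for i :: nat using that by auto
  show "1\<^sub>m 2 * N = N"
    using assms by (intro eq_matI)
      (auto simp: index_mult_mat_2 simp del: index_mult_mat(1) dest!: ij)
  show "N * 1\<^sub>m 2 = N"
    using assms by (intro eq_matI)
      (auto simp: index_mult_mat_2 simp del: index_mult_mat(1) dest!: ij)
qed

text \<open>Isolates the product \<open>Q\<close> of the inner matrices as a left factor, so that
  the last matrix of a cycle can be split off the fold.\<close>

lemma foldr_quiddity_mat:
  "\<exists>Q\<in>carrier_mat 2 2. \<forall>N\<in>carrier_mat 2 2.
    foldr (*) (map quiddity_mat p) N = Q * (N :: 'a::{comm_ring, comm_monoid_mult} mat)"
proof (induction p)
  case Nil
  show ?case by (intro bexI[of _ "1\<^sub>m 2"]) (simp_all add: one_mult_mat_2)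
next
  case (Cons t p)
  then obtain Q where Q: "Q \<in> carrier_mat 2 2"
    "\<And>N. N \<in> carrier_mat 2 2 \<Longrightarrow> foldr (*) (map quiddity_mat p) (N :: 'a mat) = Q * N"
    by blast
  have "foldr (*) (map quiddity_mat (t # p)) N = quiddity_mat t * Q * N"
    if "N \<in> carrier_mat 2 2" for N :: "'a mat"
    using Q that by (simp add: assoc_mult_mat[OF quiddity_mat_carrier])
  then show ?case
    using mult_carrier_mat[OF quiddity_mat_carrier Q(1)] by blast
qed

text \<open>Three entries of the equation between \<open>?X * (Q * ?Y)\<close> and
  \<open>\<mu>\<close> times the identity suffice: the lower right one gives \<open>- \<mu>\<close>
  as the upper left entry of \<open>Q\<close>, and the off-diagonal ones are then linear in
  \<open>x\<close> and \<open>y\<close>, solvable because \<open>\<mu>\<close> is its own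
  inverse.\<close>

lemma quiddity_cycle_ends:
  fixes x y \<mu> :: "'a::{comm_ring, comm_monoid_mult}"
  assumes Q: "Q \<in> carrier_mat 2 2"
      "\<forall>N\<in>carrier_mat 2 2. foldr (*) (map quiddity_mat p) N = Q * N"
    and \<mu>: "\<mu> * \<mu> = 1" and cycle: "quiddity_cycle \<mu> (x # p @ [y])"
  shows "x = - (\<mu> * Q $$ (1, 0))" and "y = \<mu> * Q $$ (0, 1)"
proof -
  let ?X = "quiddity_mat x" and ?Y = "quiddity_mat y"
  have eq: "?X * (Q * ?Y) = \<mu> \<cdot>\<^sub>m 1\<^sub>m 2"
    using cycle Q(2)[rule_format, OF quiddity_mat_carrier]
    by (simp add: quiddity_cycle_def one_mult_mat_2(2)[OF quiddity_mat_carrier])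
  have entry: "(\<mu> \<cdot>\<^sub>m 1\<^sub>m 2) $$ (i, j) =
      ?X $$ (i, 0) * (Q $$ (0, 0) * ?Y $$ (0, j) + Q $$ (0, 1) * ?Y $$ (1, j)) +
      ?X $$ (i, 1) * (Q $$ (1, 0) * ?Y $$ (0, j) + Q $$ (1, 1) * ?Y $$ (1, j))"
    if "i < 2" and "j < 2" for i j
  proof -
    have "(0::nat) < 2" and "(1::nat) < 2" by simp_all
    note row = this[THEN index_mult_mat_2[OF Q(1) quiddity_mat_carrier], OF that(2)]
    show ?thesis
      unfolding eq[symmetric] row index_mult_mat_2[OF quiddity_mat_carrier
          mult_carrier_mat[OF Q(1) quiddity_mat_carrier] that] ..
  qed
  have "0 = x * - Q $$ (0, 0) + Q $$ (1, 0)"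
    using entry[of 0 1] unfolding index_quiddity_mat by simp
  then have e01: "Q $$ (1, 0) = x * Q $$ (0, 0)" by (simp add: algebra_simps)
  have "0 = Q $$ (0, 0) * y + Q $$ (0, 1)"
    using entry[of 1 0] unfolding index_quiddity_mat by simp
  then have e10: "Q $$ (0, 1) = - (Q $$ (0, 0) * y)" by (metis minus_unique)
  have "\<mu> = - Q $$ (0, 0)"
    using entry[of 1 1] unfolding index_quiddity_mat by simp
  then have q: "Q $$ (0, 0) = - \<mu>" by simp
  have "Q $$ (1, 0) = - (\<mu> * x)" using e01 q by (simp add: mult.commute)
  then show "x = - (\<mu> * Q $$ (1, 0))" using \<mu> by (simp add: mult.assoc[symmetric])
  have "Q $$ (0, 1) = \<mu> * y" using e10 q by simp
  then show "y = \<mu> * Q $$ (0, 1)" using \<mu> by (simp add: mult.assoc[symmetric])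
qed

text \<open>Both cycles share the matrix \<open>Q\<close>, which depends on \<open>p\<close> alone,
  and their ends are given by the same formulas in \<open>Q\<close> and
  \<open>\<mu>\<close>.\<close>

lemma quiddity_cycle_eq_if_inner_eq:
  fixes \<mu> :: "'a::{comm_ring, comm_monoid_mult}"
  assumes "\<mu> * \<mu> = 1" and "quiddity_cycle \<mu> (x # p @ [y])" and "quiddity_cycle \<mu> (u # p @ [v])"
  shows "x = u" and "y = v"
proof -
  obtain Q where Q: "Q \<in> carrier_mat 2 2"
    "\<forall>N\<in>carrier_mat 2 2. foldr (*) (map quiddity_mat p) (N :: 'a mat) = Q * N"
    using foldr_quiddity_mat by blast
  note ends = quiddity_cycle_ends[OF Q \<open>\<mu> * \<mu> = 1\<close>]
  show "x = u" using ends(1)[OF assms(2)] ends(1)[OF assms(3)] by simp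
  show "y = v" using ends(2)[OF assms(2)] ends(2)[OF assms(3)] by simp
qed

lemma qsum_commute_eqD:
  fixes \<mu> :: "'a::{comm_ring, comm_monoid_mult}"
  assumes "\<mu> * \<mu> = 1" and "length a = length b" and "2 \<le> length a"
    and "quiddity_cycle \<mu> a" and "quiddity_cycle \<mu> b" and "a \<oplus>\<^sub>q b = b \<oplus>\<^sub>q a"
  shows "a = b"
proof -
  obtain x p y where a: "a = x # p @ [y]" using assms(3) by (rule list_ends)
  obtain u q v where b: "b = u # q @ [v]" using assms(2,3) by (metis list_ends)
  \<comment> \<open>Dropping the common first entry leaves inner blocks of equal length in front, so
    \<open>p\<close> and \<open>q\<close> coincide.\<close>
  have "p @ (y + u) # q = q @ (v + x) # p"
    using assms(6) unfolding a b qsum_Cons_snoc by (rule list.inject[THEN iffD1, THEN conjunct2])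
  moreover have "length p = length q"
    using assms(2) by (simp add: a b)
  ultimately have "p = q"
    using append_eq_append_conv by blast
  then show ?thesis
    using quiddity_cycle_eq_if_inner_eq[OF assms(1)] assms(4,5) unfolding a b by metis
qed

theorem theorem2p3:
  fixes R :: "'a::{comm_ring, comm_monoid_mult} set"
    and \<mu>1 \<mu>2 \<mu>3 :: 'a
    and k l m :: nat
    and a b c :: "'a list"
  assumes "\<mu>1 \<in> {1, - 1}" and "\<mu>2 \<in> {1, - 1}" and "\<mu>3 \<in> {1, - 1}"
    and "k > 2" and "l > 2" and "m > 2"
    and "set a \<subseteq> R" and "length a = k" and "quiddity_cycle \<mu>1 a"
    and "set b \<subseteq> R" and "length b = l" and "quiddity_cycle \<mu>2 b"
    and "set c \<subseteq> R" and "length c = m" and "quiddity_cycle \<mu>3 c"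
  shows "a \<oplus>\<^sub>q b \<sim>\<^sub>D b \<oplus>\<^sub>q a
    \<and> (\<exists>\<tau>\<in>dihedral l. \<exists>\<sigma>\<in>dihedral (l + m - 2).
          (a \<oplus>\<^sub>q b) \<oplus>\<^sub>q c = a \<oplus>\<^sub>q act (act b \<tau> \<oplus>\<^sub>q c) \<sigma>)
    \<and> (\<forall>\<sigma>\<in>dihedral (l + m - 2).
          (\<exists>\<tau>1\<in>dihedral m. \<exists>\<tau>2\<in>dihedral (k + m - 2).
             a \<oplus>\<^sub>q act (b \<oplus>\<^sub>q c) \<sigma> \<sim>\<^sub>D act (a \<oplus>\<^sub>q act c \<tau>1) \<tau>2 \<oplus>\<^sub>q b)
        \<or> (\<exists>\<tau>1\<in>dihedral l. \<exists>\<tau>2\<in>dihedral (k + l - 2).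
             a \<oplus>\<^sub>q act (b \<oplus>\<^sub>q c) \<sigma> \<sim>\<^sub>D act (a \<oplus>\<^sub>q act b \<tau>1) \<tau>2 \<oplus>\<^sub>q c))
    \<and> (k = l \<and> \<mu>1 = \<mu>2 \<and> a \<oplus>\<^sub>q b = b \<oplus>\<^sub>q a \<longrightarrow> a = b)"
proof (intro conjI ballI impI)
  show "a \<oplus>\<^sub>q b \<sim>\<^sub>D b \<oplus>\<^sub>q a"
    using assms by (intro qsum_commute) simp_all
next
  obtain b' w where *: "b' \<sim>\<^sub>D b" "w \<sim>\<^sub>D b' \<oplus>\<^sub>q c" "(a \<oplus>\<^sub>q b) \<oplus>\<^sub>q c = a \<oplus>\<^sub>q w"
    using qsum_assoc_rotated[of a b c] assms by auto
  obtain \<tau> where \<tau>: "\<tau> \<in> dihedral l" "b' = act b \<tau>"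
    using *(1) assms dihedral_equiv_iff_act by blast
  have "length (b' \<oplus>\<^sub>q c) = l + m - 2"
    using assms \<tau> by (simp add: length_qsum)
  then obtain \<sigma> where "\<sigma> \<in> dihedral (l + m - 2)" "w = act (b' \<oplus>\<^sub>q c) \<sigma>"
    using *(2) dihedral_equiv_iff_act by blast
  with * \<tau> show "\<exists>\<tau>\<in>dihedral l. \<exists>\<sigma>\<in>dihedral (l + m - 2).
      (a \<oplus>\<^sub>q b) \<oplus>\<^sub>q c = a \<oplus>\<^sub>q act (act b \<tau> \<oplus>\<^sub>q c) \<sigma>"
    by blast
next
  fix \<sigma> assume \<sigma>: "\<sigma> \<in> dihedral (l + m - 2)"
  have "length (b \<oplus>\<^sub>q c) = l + m - 2"
    using assms by (simp add: length_qsum)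
  then have "act (b \<oplus>\<^sub>q c) \<sigma> \<sim>\<^sub>D b \<oplus>\<^sub>q c"
    using \<sigma> dihedral_equiv_iff_act by blast
  then have glued: "(\<exists>c' y. c' \<sim>\<^sub>D c \<and> y \<sim>\<^sub>D a \<oplus>\<^sub>q c' \<and> a \<oplus>\<^sub>q act (b \<oplus>\<^sub>q c) \<sigma> \<sim>\<^sub>D y \<oplus>\<^sub>q b) \<or>
      (\<exists>b' y. b' \<sim>\<^sub>D b \<and> y \<sim>\<^sub>D a \<oplus>\<^sub>q b' \<and> a \<oplus>\<^sub>q act (b \<oplus>\<^sub>q c) \<sigma> \<sim>\<^sub>D y \<oplus>\<^sub>q c)"
    using assms by (intro qsum_glue_cases) simp_all
  \<comment> \<open>Turns the equivalences of \<open>glued\<close> into group elements, uniformly in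
    which of \<open>b\<close> and \<open>c\<close> is attached to \<open>a\<close> first.\<close>
  have acts: "\<exists>\<tau>1\<in>dihedral n. \<exists>\<tau>2\<in>dihedral (k + n - 2).
      z \<sim>\<^sub>D act (a \<oplus>\<^sub>q act d \<tau>1) \<tau>2 \<oplus>\<^sub>q e"
    if prems: "2 < n" "length d = n" "d' \<sim>\<^sub>D d" "y \<sim>\<^sub>D a \<oplus>\<^sub>q d'" "z \<sim>\<^sub>D y \<oplus>\<^sub>q e"
    for n and d d' e y z :: "'a list"
  proof -
    obtain \<tau>1 where \<tau>1: "\<tau>1 \<in> dihedral n" "d' = act d \<tau>1"
      using prems(2,3) dihedral_equiv_iff_act by blast
    have "length (a \<oplus>\<^sub>q d') = k + n - 2"
      using assms prems \<tau>1 by (simp add: length_qsum)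
    then obtain \<tau>2 where "\<tau>2 \<in> dihedral (k + n - 2)" "y = act (a \<oplus>\<^sub>q d') \<tau>2"
      using prems(4) dihedral_equiv_iff_act by blast
    with prems(5) \<tau>1 show ?thesis by blast
  qed
  from glued show "(\<exists>\<tau>1\<in>dihedral m. \<exists>\<tau>2\<in>dihedral (k + m - 2).
        a \<oplus>\<^sub>q act (b \<oplus>\<^sub>q c) \<sigma> \<sim>\<^sub>D act (a \<oplus>\<^sub>q act c \<tau>1) \<tau>2 \<oplus>\<^sub>q b)
      \<or> (\<exists>\<tau>1\<in>dihedral l. \<exists>\<tau>2\<in>dihedral (k + l - 2).
        a \<oplus>\<^sub>q act (b \<oplus>\<^sub>q c) \<sigma> \<sim>\<^sub>D act (a \<oplus>\<^sub>q act b \<tau>1) \<tau>2 \<oplus>\<^sub>q c)"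
    using acts[OF \<open>m > 2\<close> \<open>length c = m\<close>] acts[OF \<open>l > 2\<close> \<open>length b = l\<close>]
    by (elim disjE exE conjE) (rule disjI1, blast, rule disjI2, blast)
next
  assume *: "k = l \<and> \<mu>1 = \<mu>2 \<and> a \<oplus>\<^sub>q b = b \<oplus>\<^sub>q a"
  have "\<mu>1 * \<mu>1 = 1" using assms(1) by auto
  moreover have "length a = length b" and "2 \<le> length a" and "quiddity_cycle \<mu>1 b"
    using * \<open>length a = k\<close> \<open>length b = l\<close> \<open>k > 2\<close> \<open>quiddity_cycle \<mu>2 b\<close> by simp_all
  ultimately show "a = b"
    using * \<open>quiddity_cycle \<mu>1 a\<close> qsum_commute_eqD by blast
qed

end
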